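(* Let $\rho\in(0,\infty)$ and $\tilde\rho=\sqrt{1+\rho^2}$. Let $X\subset\mathbb{R}^N$ be a nonempty compact set that is disjoint from the relative interior of its convex hull, and let $u:X\to\mathbb{R}$ be a continuous function. Suppose there exists a continuous mapping $\sigma:X\to\mathbb{S}^{N-1}$ such that $\bar\sigma(p):=\tilde\rho\cdot(\sigma(p),0)\in N^{\tilde\rho}_{\tilde p}\tilde X\subset\mathbb{S}^N(\tilde\rho)$ for all $p\in X$. Then $$|N^{u,\rho}X/\sigma|\ \ge\ \frac12\,|\mathbb{S}^{N-1}(\rho)|.$$
   Context: $\mathbb{S}^{k}(r)$ denotes the sphere of radius $r$ centered at the origin in $\mathbb{R}^{k+1}$, $\mathbb{S}^{k}=\mathbb{S}^k(1)$, and $|\cdot|$ denotes $(N-1)$-dimensional area (Hausdorff measure) of subsets of $\mathbb{S}^{N-1}(\rho)$. Generalized normal cone of length $\rho$ of $X$ at $p\in X$ with respect to $u$: $$N^{u,\rho}_pX=\{\xi\in\mathbb{S}^{N-1}(\rho)\mid \langle x-p,\xi\rangle\le u(x)-u(p)\ \ \forall x\in X\}.$$ For $\eta\in\mathbb{S}^{N-1}$ let $H_\eta=\{y\in\mathbb{R}^N\mid\langle y,\eta\rangle\ge 0\}$. Generalized restricted normal cone with respect to $u$ and $\sigma:X\to\mathbb{S}^{N-1}$: $$N^{u,\rho}_pX/\sigma=N^{u,\rho}_pX\cap H_{\sigma(p)},\qquad N^{u,\rho}X/\sigma=\bigcup_{p\in X}N^{u,\rho}_pX/\sigma.$$ The graph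 of $u$ is $\tilde X=\{\tilde x:=(x,u(x))\mid x\in X\}\subset\mathbb{R}^{N+1}$, and its normal cone of length $\tilde\rho$ at $\tilde p=(p,u(p))$ is $$N^{\tilde\rho}_{\tilde p}\tilde X=\{\bar\xi\in\mathbb{S}^{N}(\tilde\rho)\mid\langle\tilde x-\tilde p,\bar\xi\rangle\le 0\ \ \forall\tilde x\in\tilde X\}.$$ *)

theory Defs
  imports "HOL-Analysis.Analysis"
begin

(* Hausdorff measure with the usual normalisation: the weight of a set is the volume of a
   k-dimensional ball of the same diameter.  The empty set is treated separately because
   0 ^ 0 = 1, so that for k = 0 one obtains the counting measure. *)
definition hausdorff_weight :: "nat \<Rightarrow> 'a::metric_space set \<Rightarrow> ennreal" where
  "hausdorff_weight k E =
     (if E = {} then 0 else ennreal (unit_ball_vol (real k) * (diameter E / 2) ^ k))"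

(* Covering sets are required to be bounded since the library's diameter of an unbounded set
   is an unspecified real number.  If there is no admissible cover, the infimum is infinite. *)
definition hausdorff_content :: "nat \<Rightarrow> real \<Rightarrow> 'a::metric_space set \<Rightarrow> ennreal" where
  "hausdorff_content k \<delta> A =
     (INF C \<in> {C :: nat \<Rightarrow> 'a set.
                  A \<subseteq> (\<Union>i. C i) \<and> (\<forall>i. bounded (C i) \<and> diameter (C i) \<le> \<delta>)}.
        (\<Sum>i. hausdorff_weight k (C i)))"

(* The content is antimonotone in \<delta>, so this supremum is the limit as \<delta> tends to 0. *)
definition hausdorff_measure :: "nat \<Rightarrow> 'a::metric_space set \<Rightarrow> ennreal" where
  "hausdorff_measure k A = (SUP \<delta>\<in>{0<..}. hausdorff_content k \<delta> A)"

definition gen_normal_cone ::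
  "('a::real_inner \<Rightarrow> real) \<Rightarrow> real \<Rightarrow> 'a set \<Rightarrow> 'a \<Rightarrow> 'a set" where
  "gen_normal_cone u \<rho> X p = {\<xi> \<in> sphere 0 \<rho>. \<forall>x\<in>X. (x - p) \<bullet> \<xi> \<le> u x - u p}"

definition half_space :: "'a::real_inner \<Rightarrow> 'a set" where
  "half_space \<eta> = {y. y \<bullet> \<eta> \<ge> 0}"

definition restr_normal_cone_at ::
  "('a::real_inner \<Rightarrow> real) \<Rightarrow> real \<Rightarrow> 'a set \<Rightarrow> ('a \<Rightarrow> 'a) \<Rightarrow> 'a \<Rightarrow> 'a set" where
  "restr_normal_cone_at u \<rho> X \<sigma> p = gen_normal_cone u \<rho> X p \<inter> half_space (\<sigma> p)"

definition restr_normal_cone ::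
  "('a::real_inner \<Rightarrow> real) \<Rightarrow> real \<Rightarrow> 'a set \<Rightarrow> ('a \<Rightarrow> 'a) \<Rightarrow> 'a set" where
  "restr_normal_cone u \<rho> X \<sigma> = (\<Union>p\<in>X. restr_normal_cone_at u \<rho> X \<sigma> p)"

definition normal_cone :: "real \<Rightarrow> 'a::real_inner set \<Rightarrow> 'a \<Rightarrow> 'a set" where
  "normal_cone r Y q = {\<xi> \<in> sphere 0 r. \<forall>y\<in>Y. (y - q) \<bullet> \<xi> \<le> 0}"

(* For X in R^N the graph lives in the product of R^N and R, which with the library's product
   inner product is Euclidean R^(N+1). *)
definition graph_over :: "'a set \<Rightarrow> ('a \<Rightarrow> 'b) \<Rightarrow> ('a \<times> 'b) set" where
  "graph_over X u = (\<lambda>x. (x, u x)) ` X"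

end

theory Submission
  imports Defs
begin

text \<open>The vector \<open>\<sigma> p\<close> supports \<open>X\<close> at \<open>p\<close>, so adding a nonnegative multiple of it keeps a vector
  inside the generalized normal cone at \<open>p\<close>. Hence the reflection in the hyperplane orthogonal to
  \<open>\<sigma> p\<close> maps the part of that cone outside the half-space of \<open>\<sigma> p\<close> into the part inside, which
  therefore has at least half of the area. For finite \<open>X\<close> the cones cover the sphere and overlap
  only in hyperplane slices of it, which are null in dimension at least two, so the areas add up.
  A compact \<open>X\<close> is exhausted by finite subsets: the upper limit of their restricted cones lies in
  that of \<open>X\<close>. In dimension one slices are not null, but the sphere has just two points and it
  suffices that the restricted cone is nonempty.\<close>

section \<open>Hausdorff measure as an outer measure\<close>

lemma hausdorff_content_mono:
  "A \<subseteq> B \<Longrightarrow> hausdorff_content k \<delta> A \<le> hausdorff_content k \<delta> B"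
  unfolding hausdorff_content_def by (intro INF_superset_mono) auto

lemma hausdorff_content_antimono:
  "\<delta> \<le> \<delta>' \<Longrightarrow> hausdorff_content k \<delta>' A \<le> hausdorff_content k \<delta> A"
  unfolding hausdorff_content_def by (intro INF_superset_mono) (auto intro: order_trans)

lemma hausdorff_content_le:
  assumes "A \<subseteq> (\<Union>i. C i)" "\<And>i. bounded (C i)" "\<And>i. diameter (C i) \<le> \<delta>"
  shows "hausdorff_content k \<delta> A \<le> (\<Sum>i. hausdorff_weight k (C i))"
  unfolding hausdorff_content_def using assms by (intro INF_lower) auto

lemma hausdorff_content_less_obtain:
  assumes "hausdorff_content k \<delta> A < c"
  obtains C where "A \<subseteq> (\<Union>i. C i)" "\<And>i. bounded (C i)" "\<And>i. diameter (C i) \<le> \<delta>"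
    "(\<Sum>i. hausdorff_weight k (C i)) < c"
  using assms unfolding hausdorff_content_def INF_less_iff by auto

lemma hausdorff_weight_empty [simp]: "hausdorff_weight k {} = 0"
  by (simp add: hausdorff_weight_def)

text \<open>The finite family is padded to a sequence with empty sets. These have weight 0 even for
  \<open>k = 0\<close>, and their diameter 0 is admissible because
  \<open>0 \<le> \<delta>\<close>.\<close>

lemma hausdorff_content_finite_cover:
  assumes "finite I" "A \<subseteq> (\<Union>i\<in>I. C i)" "\<And>i. i \<in> I \<Longrightarrow> bounded (C i)"
    "\<And>i. i \<in> I \<Longrightarrow> diameter (C i) \<le> \<delta>" "0 \<le> \<delta>"
  shows "hausdorff_content k \<delta> A \<le> (\<Sum>i\<in>I. hausdorff_weight k (C i))"
proof -
  obtain h where h: "bij_betw h {0..<card I} I"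
    using ex_bij_betw_nat_finite[OF \<open>finite I\<close>] by blast
  define D where "D n = (if n < card I then C (h n) else {})" for n
  have hI: "h n \<in> I" if "n < card I" for n
    using h that by (auto simp: bij_betw_def)
  have "A \<subseteq> (\<Union>n. D n)"
  proof
    fix x assume "x \<in> A"
    then obtain i where i: "i \<in> I" "x \<in> C i" using assms(2) by auto
    then obtain n where "n < card I" "h n = i"
      using h by (metis atLeastLessThan_iff bij_betw_iff_bijections)
    then show "x \<in> (\<Union>n. D n)" using i by (auto simp: D_def intro!: exI[of _ n])
  qed
  then have "hausdorff_content k \<delta> A \<le> (\<Sum>n. hausdorff_weight k (D n))"
    using hI assms by (intro hausdorff_content_le) (auto simp: D_def)
  also have "\<dots> = (\<Sum>n\<in>{0..<card I}. hausdorff_weight k (D n))"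
    by (intro suminf_finite) (auto simp: D_def)
  also have "\<dots> = (\<Sum>n\<in>{0..<card I}. hausdorff_weight k (C (h n)))"
    by (intro sum.cong) (auto simp: D_def)
  also have "\<dots> = (\<Sum>i\<in>I. hausdorff_weight k (C i))"
    by (rule sum.reindex_bij_betw[OF h])
  finally show ?thesis .
qed

lemma hausdorff_content_countably_subadditive:
  "hausdorff_content k \<delta> (\<Union>n. A n) \<le> (\<Sum>n. hausdorff_content k \<delta> (A n))"
    for A :: "nat \<Rightarrow> 'a::metric_space set"
proof (rule ennreal_le_epsilon)
  fix e :: real assume e: "0 < e" and fin: "(\<Sum>n. hausdorff_content k \<delta> (A n)) < top"
  have "hausdorff_content k \<delta> (A n) < hausdorff_content k \<delta> (A n) + e * (1/2)^Suc n" for n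
    using fin e by (auto simp: less_top dest!: ennreal_suminf_lessD)
  then have "\<exists>C. A n \<subseteq> (\<Union>i. C i) \<and> (\<forall>i. bounded (C i) \<and> diameter (C i) \<le> \<delta>) \<and>
      (\<Sum>i. hausdorff_weight k (C i)) < hausdorff_content k \<delta> (A n) + e * (1/2)^Suc n" for n
    by (rule hausdorff_content_less_obtain) auto
  then obtain B where cover: "\<And>n. A n \<subseteq> (\<Union>i. B n i)"
    and small: "\<And>n i. bounded (B n i)" "\<And>n i. diameter (B n i) \<le> \<delta>"
    and less: "\<And>n. (\<Sum>i. hausdorff_weight k (B n i)) < hausdorff_content k \<delta> (A n) + e * (1/2)^Suc n"
    by metis
  \<comment> \<open>\<open>prod_decode\<close> merges the covers \<open>B n\<close>, each within
    \<open>e * (1/2)^Suc n\<close> of the optimum, into one sequence; these errors add up to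
    \<open>e\<close>.\<close>
  define C where "C = case_prod B \<circ> prod_decode"
  have "(\<Union>n. A n) \<subseteq> (\<Union>i. C i)"
    using cover by (auto simp: C_def subset_eq) (metis prod.case prod_encode_inverse)
  then have "hausdorff_content k \<delta> (\<Union>n. A n) \<le> (\<Sum>i. hausdorff_weight k (C i))"
    using small by (intro hausdorff_content_le) (auto simp: C_def split_def)
  also have "\<dots> = (\<Sum>n. \<Sum>i. hausdorff_weight k (B n i))"
    using suminf_ennreal_2dimen[of "\<lambda>n. \<Sum>i. hausdorff_weight k (B n i)"
        "\<lambda>p. hausdorff_weight k (case_prod B p)"] by (simp add: C_def)
  also have "\<dots> \<le> (\<Sum>n. hausdorff_content k \<delta> (A n) + e * (1/2)^Suc n)"
    using less by (intro suminf_le less_imp_le) auto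
  also have "\<dots> = (\<Sum>n. hausdorff_content k \<delta> (A n)) + (\<Sum>n. ennreal e * ennreal ((1/2) ^ Suc n))"
    using \<open>0 < e\<close> by (subst suminf_add[symmetric])
      (auto simp del: ennreal_suminf_cmult simp add: ennreal_mult[symmetric])
  also have "\<dots> = (\<Sum>n. hausdorff_content k \<delta> (A n)) + e"
    unfolding ennreal_suminf_cmult
    by (subst suminf_ennreal_eq[OF zero_le_power power_half_series]) auto
  finally show "hausdorff_content k \<delta> (\<Union>n. A n) \<le> (\<Sum>n. hausdorff_content k \<delta> (A n)) + e" .
qed

section \<open>Passage from the contents to the measure\<close>

lemma hausdorff_content_le_measure:
  "0 < \<delta> \<Longrightarrow> hausdorff_content k \<delta> A \<le> hausdorff_measure k A"
  unfolding hausdorff_measure_def by (intro SUP_upper) auto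

text \<open>By antimonotonicity of the content only small scales matter for the supremum.\<close>

lemma hausdorff_measure_leI:
  assumes "0 < \<delta>0" "\<And>\<delta>. 0 < \<delta> \<Longrightarrow> \<delta> \<le> \<delta>0 \<Longrightarrow> hausdorff_content k \<delta> A \<le> c"
  shows "hausdorff_measure k A \<le> c"
  unfolding hausdorff_measure_def
proof (rule SUP_least)
  fix \<delta> :: real assume "\<delta> \<in> {0<..}"
  then have "hausdorff_content k (min \<delta> \<delta>0) A \<le> c" using assms by auto
  then show "hausdorff_content k \<delta> A \<le> c"
    using hausdorff_content_antimono[of "min \<delta> \<delta>0" \<delta> k A] by (auto intro: order_trans)
qed

lemma hausdorff_measure_mono:
  "A \<subseteq> B \<Longrightarrow> hausdorff_measure k A \<le> hausdorff_measure k B"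
  unfolding hausdorff_measure_def by (intro SUP_mono) (auto intro: hausdorff_content_mono)

lemma hausdorff_measure_empty [simp]: "hausdorff_measure k ({} :: 'a::metric_space set) = 0"
proof -
  have "hausdorff_content k \<delta> ({} :: 'a set) \<le> 0" if "0 < \<delta>" for \<delta>
    using hausdorff_content_finite_cover[of "{}" "{}" "\<lambda>_. {}" \<delta> k] that by simp
  then have "hausdorff_measure k ({} :: 'a set) \<le> 0" by (intro hausdorff_measure_leI[of 1]) auto
  then show ?thesis by simp
qed

lemma hausdorff_measure_countably_subadditive:
  "hausdorff_measure k (\<Union>n. A n) \<le> (\<Sum>n. hausdorff_measure k (A n))"
  for A :: "nat \<Rightarrow> 'a::metric_space set"
proof (rule hausdorff_measure_leI[of 1])
  fix \<delta> :: real assume "0 < \<delta>"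
  have "hausdorff_content k \<delta> (\<Union>n. A n) \<le> (\<Sum>n. hausdorff_content k \<delta> (A n))"
    by (rule hausdorff_content_countably_subadditive)
  also have "\<dots> \<le> (\<Sum>n. hausdorff_measure k (A n))"
    using \<open>0 < \<delta>\<close> by (intro suminf_le hausdorff_content_le_measure) auto
  finally show "hausdorff_content k \<delta> (\<Union>n. A n) \<le> (\<Sum>n. hausdorff_measure k (A n))" .
qed simp

lemma hausdorff_measure_finite_subadditive:
  fixes A :: "'i \<Rightarrow> 'a::metric_space set"
  assumes "finite I"
  shows "hausdorff_measure k (\<Union>i\<in>I. A i) \<le> (\<Sum>i\<in>I. hausdorff_measure k (A i))"
proof -
  have un: "hausdorff_measure k (B \<union> C) \<le> hausdorff_measure k B + hausdorff_measure k C"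
    for B C :: "'a set"
  proof -
    have "hausdorff_measure k (B \<union> C)
        \<le> (\<Sum>n. hausdorff_measure k (if n = 0 then B else if n = Suc 0 then C else {}))"
      using hausdorff_measure_countably_subadditive
        [of k "\<lambda>n::nat. if n = 0 then B else if n = Suc 0 then C else {}"]
      by (rule order_trans[OF hausdorff_measure_mono, rotated]) force
    also have "\<dots> = hausdorff_measure k B + hausdorff_measure k C"
      by (subst suminf_finite[of "{0, Suc 0}"]) auto
    finally show ?thesis .
  qed
  show ?thesis using assms
    by induction (auto intro: order_trans[OF un] add_left_mono)
qed

lemma hausdorff_measure_Un_le:
  "hausdorff_measure k (A \<union> B) \<le> hausdorff_measure k A + hausdorff_measure k B"
  using hausdorff_measure_finite_subadditive[of "UNIV :: bool set" k "\<lambda>b. if b then A else B"]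
  by (simp add: UNIV_bool Un_commute add.commute)

text \<open>At scales below \<open>d\<close> no covering set meets both \<open>A\<close> and
  \<open>B\<close>, so every cover of the union splits into a cover of each. This makes the
  Hausdorff measure a metric outer measure.\<close>

lemma hausdorff_measure_Un_separated:
  fixes A B :: "'a::metric_space set"
  assumes "0 < d" and sep: "\<And>x y. x \<in> A \<Longrightarrow> y \<in> B \<Longrightarrow> d \<le> dist x y"
  shows "hausdorff_measure k (A \<union> B) = hausdorff_measure k A + hausdorff_measure k B"
proof (rule antisym[OF hausdorff_measure_Un_le])
  have main: "hausdorff_content k \<delta> A + hausdorff_content k \<delta> B \<le> hausdorff_content k \<delta> (A \<union> B)"
    if \<delta>: "0 < \<delta>" "\<delta> < d" for \<delta>
    unfolding hausdorff_content_def[of k \<delta> "A \<union> B"]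
  proof (rule INF_greatest, clarify)
    fix C :: "nat \<Rightarrow> 'a set"
    assume cover: "A \<union> B \<subseteq> (\<Union>i. C i)" and C: "\<forall>i. bounded (C i) \<and> diameter (C i) \<le> \<delta>"
    define D where "D S i = (if C i \<inter> S = {} then {} else C i)" for S i
    have le: "hausdorff_content k \<delta> S \<le> (\<Sum>i. hausdorff_weight k (D S i))" if "S \<subseteq> A \<union> B" for S
      using C cover that \<delta> by (intro hausdorff_content_le) (auto simp: D_def, fastforce)
    have disj: "C i \<inter> A = {} \<or> C i \<inter> B = {}" for i
    proof (rule ccontr)
      assume "\<not> ?thesis"
      then obtain x y where "x \<in> C i" "x \<in> A" "y \<in> C i" "y \<in> B" by blast
      then have "d \<le> diameter (C i)"
        using sep diameter_bounded_bound[of "C i" x y] C by fastforce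
      then show False using C \<delta> by (meson leD order_trans)
    qed
    have "hausdorff_content k \<delta> A + hausdorff_content k \<delta> B
        \<le> (\<Sum>i. hausdorff_weight k (D A i)) + (\<Sum>i. hausdorff_weight k (D B i))"
      by (intro add_mono le) auto
    also have "\<dots> = (\<Sum>i. hausdorff_weight k (D A i) + hausdorff_weight k (D B i))"
      by (intro suminf_add) auto
    also have "\<dots> \<le> (\<Sum>i. hausdorff_weight k (C i))"
      using disj by (intro suminf_le) (auto simp: D_def)
    finally show "hausdorff_content k \<delta> A + hausdorff_content k \<delta> B
        \<le> (\<Sum>i. hausdorff_weight k (C i))" .
  qed
  \<comment> \<open>The two suprema run over independent scales; both contents are compared at the
    common scale \<open>m\<close>, which also lies below \<open>d\<close>.\<close>
  have sum_le: "hausdorff_content k \<delta> A + hausdorff_content k \<delta>' B \<le> hausdorff_measure k (A \<union> B)"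
    if "0 < \<delta>" "0 < \<delta>'" for \<delta> \<delta>'
  proof -
    define m where "m = min (min \<delta> \<delta>') (d/2)"
    have "hausdorff_content k \<delta> A + hausdorff_content k \<delta>' B
        \<le> hausdorff_content k m A + hausdorff_content k m B"
      by (intro add_mono hausdorff_content_antimono) (auto simp: m_def)
    also have "\<dots> \<le> hausdorff_content k m (A \<union> B)"
      using that \<open>0 < d\<close> by (intro main) (auto simp: m_def)
    also have "\<dots> \<le> hausdorff_measure k (A \<union> B)"
      using that \<open>0 < d\<close> by (intro hausdorff_content_le_measure) (auto simp: m_def)
    finally show ?thesis .
  qed
  have "hausdorff_content k \<delta> A + hausdorff_measure k B \<le> hausdorff_measure k (A \<union> B)"
    if "0 < \<delta>" for \<delta>
    unfolding hausdorff_measure_def[of k B] using that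
    by (subst ennreal_SUP_add_right) (auto intro!: SUP_least sum_le)
  then show "hausdorff_measure k A + hausdorff_measure k B \<le> hausdorff_measure k (A \<union> B)"
    unfolding hausdorff_measure_def[of k A]
    by (subst ennreal_SUP_add_left[symmetric]) (auto intro!: SUP_least)
qed

text \<open>A cover of \<open>A\<close> at scale \<open>\<delta> / L\<close> is carried to a cover
  of the image at scale \<open>\<delta>\<close>. Its members are first cut down to \<open>A\<close>,
  since the Lipschitz bound holds only there.\<close>

lemma hausdorff_measure_Lipschitz_image_le:
  fixes f :: "'a::metric_space \<Rightarrow> 'b::metric_space"
  assumes "0 < L" and lip: "\<And>x y. x \<in> A \<Longrightarrow> y \<in> A \<Longrightarrow> dist (f x) (f y) \<le> L * dist x y"
  shows "hausdorff_measure k (f ` A) \<le> ennreal (L ^ k) * hausdorff_measure k A"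
proof (rule hausdorff_measure_leI[of 1])
  fix \<delta> :: real assume \<delta>: "0 < \<delta>"
  \<comment> \<open>With the factor moved to the left, the right side is a bare infimum and each
    cover can be treated separately.\<close>
  have "ennreal (1 / L ^ k) * hausdorff_content k \<delta> (f ` A) \<le> hausdorff_content k (\<delta> / L) A"
    unfolding hausdorff_content_def[of k "\<delta> / L"]
  proof (rule INF_greatest, clarify)
    fix C :: "nat \<Rightarrow> 'a set"
    assume cover: "A \<subseteq> (\<Union>i. C i)" and C: "\<forall>i. bounded (C i) \<and> diameter (C i) \<le> \<delta> / L"
    define D where "D i = f ` (C i \<inter> A)" for i
    have dist_le: "dist (f x) (f y) \<le> L * diameter (C i)" if "x \<in> C i \<inter> A" "y \<in> C i \<inter> A" for i x y
    proof -
      have "dist x y \<le> diameter (C i)" using diameter_bounded_bound C that by blast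
      then show ?thesis using lip[of x y] that \<open>0 < L\<close> by (auto intro: order_trans)
    qed
    have diam: "diameter (D i) \<le> L * diameter (C i)" for i
    proof (cases "D i = {}")
      case True
      then show ?thesis using C \<open>0 < L\<close> diameter_ge_0[of "C i"] by simp
    next
      case False
      then show ?thesis
        unfolding diameter_def[of "D i"] using dist_le by (auto simp: D_def intro!: cSUP_least)
    qed
    have bdd: "bounded (D i)" for i
    proof (cases "D i = {}")
      case False
      then obtain x where "x \<in> C i \<inter> A" by (auto simp: D_def)
      then show ?thesis unfolding bounded_def D_def using dist_le[of x i] by blast
    qed simp
    have weight: "hausdorff_weight k (D i) \<le> ennreal (L ^ k) * hausdorff_weight k (C i)" for i
    proof (cases "D i = {}")
      case False
      then have "C i \<noteq> {}" by (auto simp: D_def)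
      have "hausdorff_weight k (D i) \<le> ennreal (unit_ball_vol (real k) * (L * diameter (C i) / 2) ^ k)"
        using False diam[of i] diameter_ge_0[OF bdd[of i]]
        by (auto simp: hausdorff_weight_def intro!: ennreal_leI mult_left_mono power_mono)
      also have "\<dots> = ennreal (L ^ k) * hausdorff_weight k (C i)"
        using \<open>C i \<noteq> {}\<close> \<open>0 < L\<close> C diameter_ge_0[of "C i"]
        by (simp add: hausdorff_weight_def ennreal_mult[symmetric] power_mult_distrib
            power_divide ac_simps)
      finally show ?thesis .
    qed simp
    have "hausdorff_content k \<delta> (f ` A) \<le> (\<Sum>i. hausdorff_weight k (D i))"
    proof (rule hausdorff_content_le)
      show "f ` A \<subseteq> (\<Union>i. D i)" unfolding D_def using cover by blast
      show "diameter (D i) \<le> \<delta>" for i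
        using diam[of i] C[rule_format, of i] \<open>0 < L\<close> by (simp add: field_simps)
    qed (rule bdd)
    also have "\<dots> \<le> (\<Sum>i. ennreal (L ^ k) * hausdorff_weight k (C i))"
      using weight by (intro suminf_le) auto
    finally have "ennreal (1 / L ^ k) * hausdorff_content k \<delta> (f ` A)
        \<le> ennreal (1 / L ^ k) * (ennreal (L ^ k) * (\<Sum>i. hausdorff_weight k (C i)))"
      by (intro mult_left_mono) auto
    also have "\<dots> = (\<Sum>i. hausdorff_weight k (C i))"
      using \<open>0 < L\<close> by (simp add: mult.assoc[symmetric] ennreal_mult[symmetric])
    finally show "ennreal (1 / L ^ k) * hausdorff_content k \<delta> (f ` A)
        \<le> (\<Sum>i. hausdorff_weight k (C i))" .
  qed
  also have "\<dots> \<le> hausdorff_measure k A"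
    using \<delta> \<open>0 < L\<close> by (intro hausdorff_content_le_measure) auto
  finally have "ennreal (L ^ k) * (ennreal (1 / L ^ k) * hausdorff_content k \<delta> (f ` A))
      \<le> ennreal (L ^ k) * hausdorff_measure k A"
    by (intro mult_left_mono) auto
  then show "hausdorff_content k \<delta> (f ` A) \<le> ennreal (L ^ k) * hausdorff_measure k A"
    using \<open>0 < L\<close> by (simp add: mult.assoc[symmetric] ennreal_mult[symmetric])
qed simp

section \<open>Measurability of Borel sets\<close>

lemma suminf_even_odd_bound:
  fixes f :: "nat \<Rightarrow> ennreal"
  assumes "\<And>m. (\<Sum>j<m. f (2 * j)) \<le> c" "\<And>m. (\<Sum>j<m. f (2 * j + 1)) \<le> c"
  shows "(\<Sum>j. f j) \<le> c + c"
proof (rule suminf_le_const)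
  fix n
  have split: "(\<Sum>j<2 * m. f j) = (\<Sum>j<m. f (2 * j)) + (\<Sum>j<m. f (2 * j + 1))" for m
    by (induction m) (auto simp: ac_simps)
  have "(\<Sum>j<n. f j) \<le> (\<Sum>j<2 * n. f j)" by (rule sum_mono2) auto
  also have "\<dots> \<le> c + c" unfolding split by (intro add_mono assms)
  finally show "(\<Sum>j<n. f j) \<le> c + c" .
qed simp

lemma infdist_diff_le_dist: "infdist x F - infdist y F \<le> dist x y"
  using infdist_triangle[of x F y] by simp

text \<open>Caratheodory's criterion: \<open>A - F\<close> is exhausted by sets at positive distance from \<open>F\<close>. The
  successive differences \<open>R n\<close> of these sets have finite total measure, because those of even index
  are pairwise separated, and likewise those of odd index.\<close>

lemma hausdorff_measure_closed_split:
  fixes F :: "'a::metric_space set"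
  assumes "closed F" "F \<noteq> {}"
  shows "hausdorff_measure k (A \<inter> F) + hausdorff_measure k (A - F) \<le> hausdorff_measure k A"
proof (cases "hausdorff_measure k A = \<infinity>")
  case False
  let ?H = "hausdorff_measure k :: 'a set \<Rightarrow> ennreal"
  define D where "D n = {x \<in> A. inverse (Suc n) \<le> infdist x F}" for n
  define R where "R n = D (Suc n) - D n" for n
  have HD: "?H (A \<inter> F) + ?H (D n) \<le> ?H A" for n
  proof -
    have "?H (A \<inter> F \<union> D n) = ?H (A \<inter> F) + ?H (D n)"
    proof (rule hausdorff_measure_Un_separated)
      fix x y assume "x \<in> A \<inter> F" "y \<in> D n"
      then show "inverse (real (Suc n)) \<le> dist x y"
        using infdist_le[of x F y] by (auto simp: D_def dist_commute)
    qed simp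
    moreover have "?H (A \<inter> F \<union> D n) \<le> ?H A"
      by (rule hausdorff_measure_mono) (auto simp: D_def)
    ultimately show ?thesis by simp
  qed
  \<comment> \<open>A point off the closed set \<open>F\<close> has positive distance to it, hence
    lies in some \<open>D m\<close>. For the least such \<open>m\<close> it is in \<open>D n\<close>
    if \<open>m \<le> n\<close>, and otherwise in \<open>R (m - 1)\<close>.\<close>
  have cover: "A - F \<subseteq> D n \<union> (\<Union>j. R (j + n))" for n
  proof
    fix x assume x: "x \<in> A - F"
    then have "0 < infdist x F"
      using assms by (simp add: infdist_pos_not_in_closed)
    then obtain m where "inverse (real (Suc m)) < infdist x F"
      using reals_Archimedean by blast
    then have ex: "\<exists>m. x \<in> D m" using x by (auto simp: D_def intro: exI[of _ m])
    define m where "m = (LEAST m. x \<in> D m)"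
    have m: "x \<in> D m" unfolding m_def using ex by (rule LeastI_ex)
    have least: "x \<notin> D i" if "i < m" for i
      using not_less_Least[OF that[unfolded m_def]] .
    have mono: "D i \<subseteq> D j" if "i \<le> j" for i j
      using that by (auto simp: D_def intro: order_trans[rotated])
    show "x \<in> D n \<union> (\<Union>j. R (j + n))"
    proof (cases "m \<le> n")
      case True
      then show ?thesis using m mono by blast
    next
      case False
      then obtain j where "m = Suc (j + n)" by (metis add.commute less_imp_Suc_add not_le)
      then have "x \<in> R (j + n)" using m least by (auto simp: R_def)
      then show ?thesis by blast
    qed
  qed
  have rings: "(\<Sum>j<m. ?H (R (2 * j + p))) \<le> ?H A" for p m
  proof -
    have "(\<Sum>j<m. ?H (R (2 * j + p))) = ?H (\<Union>j<m. R (2 * j + p))"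
    proof (induction m)
      case (Suc m)
      have "?H (R (2 * m + p) \<union> (\<Union>j<m. R (2 * j + p)))
          = ?H (R (2 * m + p)) + ?H (\<Union>j<m. R (2 * j + p))"
      \<comment> \<open>For \<open>m = 0\<close> the union is empty. The gap used below would be
        negative for \<open>m = p = 0\<close>, because \<open>inverse 0 = 0\<close>.\<close>
      proof (cases "m = 0")
        case False
        show ?thesis
        proof (rule hausdorff_measure_Un_separated)
          show "0 < inverse (real (2 * m + p)) - inverse (real (2 * m + p + 1))"
            using False less_imp_inverse_less[of "real (2 * m + p)" "real (2 * m + p + 1)"]
            by simp
          \<comment> \<open>Points of the earlier rings have distance at least
            \<open>1 / (2 * m + p)\<close> from \<open>F\<close>, points of the new one less than
            \<open>1 / (2 * m + p + 1)\<close>; the skipped index in between produces the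
            gap.\<close>
          fix y x assume y: "y \<in> R (2 * m + p)" and "x \<in> (\<Union>j<m. R (2 * j + p))"
          then obtain j where j: "j < m" "x \<in> R (2 * j + p)" by blast
          have "inverse (real (2 * m + p)) \<le> inverse (real (Suc (Suc (2 * j + p))))"
            using j by (intro le_imp_inverse_le) auto
          also have "\<dots> \<le> infdist x F" using j by (simp add: R_def D_def)
          finally have "inverse (real (2 * m + p)) \<le> infdist x F" .
          moreover have "infdist y F \<le> inverse (real (2 * m + p + 1))"
            using y by (auto simp: R_def D_def)
          ultimately show "inverse (real (2 * m + p)) - inverse (real (2 * m + p + 1)) \<le> dist y x"
            using infdist_diff_le_dist[of x F y] by (simp add: dist_commute)
        qed
      qed simp
      then show ?case using Suc by (simp add: lessThan_Suc add.commute)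
    qed simp
    also have "\<dots> \<le> ?H A"
      by (rule hausdorff_measure_mono) (auto simp: R_def D_def)
    finally show ?thesis .
  qed
  have "(\<Sum>j. ?H (R j)) \<le> ?H A + ?H A"
    using rings[of 0] rings[of 1] by (intro suminf_even_odd_bound) simp_all
  also have "\<dots> < \<infinity>" using False by (simp add: less_top)
  finally have fin: "(\<Sum>j. ?H (R j)) \<noteq> \<infinity>" by simp
  \<comment> \<open>All ring measures are finite, so they form a summable real series, whose tails
    tend to 0.\<close>
  define r where "r j = enn2real (?H (R j))" for j
  have r: "?H (R j) = ennreal (r j)" for j
    using ennreal_suminf_lessD[of "\<lambda>j. ?H (R j)" top j] fin
    by (simp add: r_def less_top)
  have r0: "0 \<le> r j" for j by (simp add: r_def)
  have summable: "summable r"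
    using fin r0 unfolding r by (intro summable_suminf_not_top) auto
  have "(\<lambda>n. ennreal (\<Sum>j. r (j + n))) \<longlonglongrightarrow> ennreal 0"
    by (intro tendsto_ennrealI suminf_exist_split2 summable)
  then have lim: "(\<lambda>n. ?H A + ennreal (\<Sum>j. r (j + n))) \<longlonglongrightarrow> ?H A + ennreal 0"
    by (intro tendsto_add tendsto_const)
  have le: "?H (A \<inter> F) + ?H (A - F) \<le> ?H A + ennreal (\<Sum>j. r (j + n))" for n
  proof -
    have "?H (A - F) \<le> ?H (D n) + ?H (\<Union>j. R (j + n))"
      using hausdorff_measure_mono[OF cover] hausdorff_measure_Un_le by (rule order_trans)
    also have "\<dots> \<le> ?H (D n) + (\<Sum>j. ?H (R (j + n)))"
      by (intro add_left_mono hausdorff_measure_countably_subadditive)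
    also have "(\<Sum>j. ?H (R (j + n))) = ennreal (\<Sum>j. r (j + n))"
      unfolding r using r0 summable by (intro suminf_ennreal2) (auto simp: summable_iff_shift)
    finally have "?H (A \<inter> F) + ?H (A - F) \<le> ?H (A \<inter> F) + (?H (D n) + ennreal (\<Sum>j. r (j + n)))"
      by (rule add_left_mono)
    also have "\<dots> \<le> ?H A + ennreal (\<Sum>j. r (j + n))"
      unfolding add.assoc[symmetric] by (intro add_right_mono HD)
    finally show ?thesis .
  qed
  have "?H (A \<inter> F) + ?H (A - F) \<le> ?H A + ennreal 0"
    by (rule LIMSEQ_le_const[OF lim]) (blast intro: le)
  then show ?thesis by simp
qed simp

text \<open>\<open>measure_of\<close> defaults to the zero measure unless the given function is a
  measure; that it is one here is part of the proof of
  \<open>emeasure_hausdorff_borel\<close>.\<close>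

definition hausdorff_borel :: "nat \<Rightarrow> 'a::metric_space measure" where
  "hausdorff_borel k = measure_of UNIV (sets borel) (hausdorff_measure k)"

lemma sets_hausdorff_borel [simp, measurable_cong]: "sets (hausdorff_borel k) = sets borel"
  and space_hausdorff_borel [simp]: "space (hausdorff_borel k) = UNIV"
  unfolding hausdorff_borel_def
  by (simp_all add: sets.sets_measure_of_eq[of borel, simplified])

lemma outer_measure_space_hausdorff_measure:
  "outer_measure_space (Pow UNIV) (hausdorff_measure k :: 'a::metric_space set \<Rightarrow> ennreal)"
  unfolding outer_measure_space_def positive_def increasing_def countably_subadditive_def
  by (auto intro: hausdorff_measure_mono hausdorff_measure_countably_subadditive)

text \<open>The sets that split every set additively form a sigma-algebra on which the outer measure
  is countably additive. Closed sets belong to it and generate the Borel sets.\<close>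

lemma emeasure_hausdorff_borel:
  fixes A :: "'a::metric_space set"
  assumes "A \<in> sets borel"
  shows "emeasure (hausdorff_borel k) A = hausdorff_measure k A"
proof -
  let ?H = "hausdorff_measure k :: 'a set \<Rightarrow> ennreal"
  let ?L = "lambda_system UNIV (Pow UNIV) ?H"
  interpret sigma_algebra UNIV "Pow UNIV :: 'a set set" by (rule sigma_algebra_Pow)
  have ms: "measure_space UNIV ?L ?H"
    by (rule caratheodory_lemma[OF outer_measure_space_hausdorff_measure])
  then have "sigma_algebra UNIV ?L" by (simp add: measure_space_def)
  moreover have "F \<in> ?L" if "closed F" for F
  proof (cases "F = {}")
    case True
    then show ?thesis by (simp add: lambda_system_def)
  next
    case False
    have "?H (S \<inter> F) + ?H (S - F) = ?H S" for S
    proof (rule antisym[OF hausdorff_measure_closed_split[OF that False]])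
      show "?H S \<le> ?H (S \<inter> F) + ?H (S - F)"
        using hausdorff_measure_Un_le[of k "S \<inter> F" "S - F"] by (simp add: Int_Diff_Un)
    qed
    then show ?thesis unfolding lambda_system_eq by simp
  qed
  ultimately have "sigma_sets UNIV (Collect closed) \<subseteq> ?L"
    by (intro sigma_algebra.sigma_sets_subset) auto
  then have sub: "sets borel \<subseteq> ?L" by (simp add: borel_eq_closed)
  have "countably_additive ?L ?H"
    using ms by (simp add: measure_space_def)
  then have "countably_additive (sets borel) ?H"
    using sub unfolding countably_additive_def by (meson subset_trans subsetD)
  moreover have "positive (sets borel) ?H" by (simp add: positive_def)
  ultimately show ?thesis
    using assms by (intro emeasure_measure_of[OF hausdorff_borel_def]) simp_all
qed

section \<open>Spheres and their hyperplane slices\<close>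

text \<open>A mean value estimate, which makes the volume of a spherical shell linear in its
  thickness.\<close>

lemma power_diff_le_mult:
  fixes a b :: real
  assumes "0 \<le> b" "b \<le> a"
  shows "a ^ Suc n - b ^ Suc n \<le> (a - b) * (real (Suc n) * a ^ n)"
proof (induction n)
  case (Suc n)
  have "a ^ Suc (Suc n) - b ^ Suc (Suc n) = a * (a ^ Suc n - b ^ Suc n) + (a - b) * b ^ Suc n"
    by (simp add: algebra_simps)
  also have "\<dots> \<le> a * ((a - b) * (real (Suc n) * a ^ n)) + (a - b) * a ^ Suc n"
    using assms by (intro add_mono mult_left_mono Suc power_mono) auto
  finally show ?case by (simp add: algebra_simps)
qed simp

text \<open>The balls of radius \<open>\<epsilon> / 2\<close> around \<open>P\<close> are disjoint and fit into a shell of thickness \<open>\<epsilon>\<close>.\<close>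

lemma card_separated_sphere_le:
  fixes P :: "'a::euclidean_space set" and \<epsilon> \<rho> :: real
  assumes "0 < \<epsilon>" "\<epsilon> \<le> \<rho>" "finite P" "P \<subseteq> sphere 0 \<rho>"
    and sep: "\<And>x y. x \<in> P \<Longrightarrow> y \<in> P \<Longrightarrow> x \<noteq> y \<Longrightarrow> \<epsilon> \<le> dist x y"
  shows "real (card P) * \<epsilon> ^ (DIM('a) - 1) \<le> 2 ^ DIM('a) * DIM('a) * (2 * \<rho>) ^ (DIM('a) - 1)"
proof -
  define n where "n = DIM('a)"
  define k where "k = n - 1"
  have n: "n = Suc k" by (simp add: k_def n_def)
  define \<omega> where "\<omega> = unit_ball_vol (real n)"
  have "0 < \<omega>" by (simp add: \<omega>_def)
  let ?U = "\<Union>p\<in>P. ball p (\<epsilon> / 2)"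
  have ball_disj: "disjnt (ball x (\<epsilon> / 2)) (ball y (\<epsilon> / 2))" if "x \<in> P" "y \<in> P" "x \<noteq> y" for x y
    using sep[OF that] by (simp add: disjoint_ballI disjnt_def)
  have "measure lebesgue ?U = (\<Sum>p\<in>P. measure lebesgue (ball p (\<epsilon> / 2)))"
    using \<open>finite P\<close> ball_disj by (intro measure_UNION') (auto simp: pairwise_def)
  then have U: "measure lebesgue ?U = real (card P) * (\<omega> * (\<epsilon> / 2) ^ n)"
    using \<open>0 < \<epsilon>\<close> by (simp add: content_ball n_def \<omega>_def)
  have "?U \<subseteq> ball 0 (\<rho> + \<epsilon> / 2) - ball 0 (\<rho> - \<epsilon> / 2)"
  proof
    fix x assume "x \<in> ?U"
    then obtain p where "p \<in> P" "dist p x < \<epsilon> / 2" by auto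
    moreover have "norm p = \<rho>" using \<open>p \<in> P\<close> assms by auto
    ultimately show "x \<in> ball 0 (\<rho> + \<epsilon> / 2) - ball 0 (\<rho> - \<epsilon> / 2)"
      using norm_triangle_ineq3[of p x] by (auto simp: dist_norm)
  qed
  then have "measure lebesgue ?U
      \<le> measure lebesgue (ball (0 :: 'a) (\<rho> + \<epsilon> / 2) - ball 0 (\<rho> - \<epsilon> / 2))"
    using \<open>finite P\<close> by (intro measure_mono_fmeasurable) auto
  also have "\<dots> = measure lebesgue (ball (0 :: 'a) (\<rho> + \<epsilon> / 2)) - measure lebesgue (ball (0 :: 'a) (\<rho> - \<epsilon> / 2))"
    using assms by (intro measurable_measure_Diff) (auto simp: subset_ball)
  also have "\<dots> = \<omega> * ((\<rho> + \<epsilon> / 2) ^ n - (\<rho> - \<epsilon> / 2) ^ n)"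
    using assms by (simp add: content_ball n_def \<omega>_def algebra_simps)
  also have "\<dots> \<le> \<omega> * (\<epsilon> * (real n * (2 * \<rho>) ^ k))"
  proof -
    have "(\<rho> + \<epsilon> / 2) ^ n - (\<rho> - \<epsilon> / 2) ^ n \<le> \<epsilon> * (real n * (\<rho> + \<epsilon> / 2) ^ k)"
      using power_diff_le_mult[of "\<rho> - \<epsilon> / 2" "\<rho> + \<epsilon> / 2" k] assms by (simp add: n)
    also have "\<dots> \<le> \<epsilon> * (real n * (2 * \<rho>) ^ k)"
      using assms by (intro mult_left_mono power_mono) auto
    finally show ?thesis using \<open>0 < \<omega>\<close> by simp
  qed
  \<comment> \<open>The thickness of the shell cancels one of the \<open>n\<close> factors
    \<open>\<epsilon>\<close> from the volume of the small balls, leaving the exponent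
    \<open>n - 1\<close>.\<close>
  finally have "(\<omega> * \<epsilon>) * (real (card P) * \<epsilon> ^ k) \<le> (\<omega> * \<epsilon>) * (2 ^ n * real n * (2 * \<rho>) ^ k)"
    unfolding U by (simp add: n field_simps)
  then show ?thesis using \<open>0 < \<omega>\<close> \<open>0 < \<epsilon>\<close> by (simp add: n_def k_def)
qed

text \<open>A maximal separated subset is a net, and the packing bound limits the total weight of
  the balls around it independently of the scale.\<close>

lemma hausdorff_measure_sphere_finite:
  fixes \<rho> :: real
  assumes "0 < \<rho>"
  shows "hausdorff_measure (DIM('a) - 1) (sphere (0 :: 'a::euclidean_space) \<rho>) < \<infinity>"
proof -
  define k where "k = DIM('a) - 1"
  define S where "S = sphere (0 :: 'a) \<rho>"
  define K :: real where "K = 2 ^ DIM('a) * DIM('a) * (2 * \<rho>) ^ k"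
  have "hausdorff_measure k S \<le> ennreal (unit_ball_vol (real k) * K)"
  proof (rule hausdorff_measure_leI[of "2 * \<rho>"])
    fix \<delta> assume \<delta>: "0 < \<delta>" "\<delta> \<le> 2 * \<rho>"
    \<comment> \<open>Balls of radius \<open>\<epsilon>\<close> then have diameter
      \<open>\<delta>\<close>, and \<open>\<delta> \<le> 2 * \<rho>\<close> gives the inequality
      \<open>\<epsilon> \<le> \<rho>\<close> that the packing bound requires.\<close>
    define \<epsilon> where "\<epsilon> = \<delta> / 2"
    have \<epsilon>: "0 < \<epsilon>" "\<epsilon> \<le> \<rho>" using \<delta> by (auto simp: \<epsilon>_def)
    define separated where "separated P \<longleftrightarrow> finite P \<and> P \<subseteq> S \<and>
      (\<forall>x\<in>P. \<forall>y\<in>P. x \<noteq> y \<longrightarrow> \<epsilon> \<le> dist x y)" for P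
    have card_le: "real (card P) * \<epsilon> ^ k \<le> K" if "separated P" for P
      using card_separated_sphere_le[of \<epsilon> \<rho> P] that \<epsilon>
      by (simp add: separated_def S_def K_def k_def)
    \<comment> \<open>A bound common to all separated sets ensures that one of largest cardinality
      exists.\<close>
    have "card P \<le> nat \<lceil>K / \<epsilon> ^ k\<rceil>" if "separated P" for P
    proof -
      have "real (card P) \<le> K / \<epsilon> ^ k" using card_le[OF that] \<epsilon> by (simp add: field_simps)
      then show ?thesis by linarith
    qed
    moreover have "separated {}" by (simp add: separated_def)
    ultimately obtain P where P: "separated P" and max: "\<And>Q. separated Q \<Longrightarrow> card Q \<le> card P"
      using ex_has_greatest_nat[of separated "{}" card] by (metis less_Suc_eq_le)
    have "S \<subseteq> (\<Union>p\<in>P. cball p \<epsilon>)"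
    proof
      fix x assume "x \<in> S"
      show "x \<in> (\<Union>p\<in>P. cball p \<epsilon>)"
      proof (rule ccontr)
        assume far: "x \<notin> (\<Union>p\<in>P. cball p \<epsilon>)"
        then have "x \<notin> P" using \<epsilon> by force
        have "separated (insert x P)"
          using P far \<open>x \<in> S\<close> by (auto simp: separated_def dist_commute not_le intro: less_imp_le)
        then have "card (insert x P) \<le> card P" by (rule max)
        then show False using P \<open>x \<notin> P\<close> by (simp add: separated_def)
      qed
    qed
    then have "hausdorff_content k \<delta> S \<le> (\<Sum>p\<in>P. hausdorff_weight k (cball p \<epsilon>))"
      using P \<epsilon> by (intro hausdorff_content_finite_cover) (auto simp: separated_def \<epsilon>_def)
    also have "\<dots> = (\<Sum>p\<in>P. ennreal (unit_ball_vol (real k) * \<epsilon> ^ k))"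
      using \<epsilon> by (intro sum.cong) (auto simp: hausdorff_weight_def)
    also have "\<dots> = ennreal (unit_ball_vol (real k) * (real (card P) * \<epsilon> ^ k))"
      using \<epsilon> by (simp add: ennreal_of_nat_eq_real_of_nat ennreal_mult[symmetric] ac_simps)
    also have "\<dots> \<le> ennreal (unit_ball_vol (real k) * K)"
      using card_le[OF P] by (intro ennreal_leI mult_left_mono) auto
    finally show "hausdorff_content k \<delta> S \<le> ennreal (unit_ball_vol (real k) * K)" .
  qed (use assms in auto)
  then show ?thesis unfolding S_def k_def by (rule order_le_less_trans) simp
qed

lemma hausdorff_measure_singleton:
  assumes "0 < k"
  shows "hausdorff_measure k {x} = 0"
proof -
  have "hausdorff_measure k {x} \<le> 0"
  proof (rule hausdorff_measure_leI[of 1])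
    fix \<delta> :: real assume "0 < \<delta>"
    then show "hausdorff_content k \<delta> {x} \<le> 0"
      using hausdorff_content_finite_cover[of "{x}" "{x}" "\<lambda>x. {x}" \<delta> k] assms
      by (simp add: hausdorff_weight_def power_0_left)
  qed simp
  then show ?thesis by simp
qed

text \<open>Slices at heights near the centre are similar to the given slice with a bounded factor,
  pairwise disjoint and contained in a set of finite measure.\<close>

lemma hausdorff_measure_sphere_slice:
  fixes v :: "'a::euclidean_space" and \<rho> c :: real
  assumes "0 < \<rho>" "2 \<le> DIM('a)" "v \<noteq> 0"
  shows "hausdorff_measure (DIM('a) - 1) (sphere 0 \<rho> \<inter> {\<xi>. \<xi> \<bullet> v = c}) = 0"
proof -
  define k where "k = DIM('a) - 1"
  have "0 < k" using assms by (simp add: k_def)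
  define e where "e = v /\<^sub>R norm v"
  have e: "e \<bullet> e = 1" using \<open>v \<noteq> 0\<close> by (simp add: e_def dot_square_norm power2_eq_square)
  define S where "S t = sphere (0 :: 'a) \<rho> \<inter> {\<xi>. \<xi> \<bullet> e = t}" for t
  define b where "b = c / norm v"
  have Sb: "sphere 0 \<rho> \<inter> {\<xi>. \<xi> \<bullet> v = c} = S b"
    using \<open>v \<noteq> 0\<close> by (auto simp: S_def b_def e_def field_simps)
  let ?H = "hausdorff_measure k :: 'a set \<Rightarrow> ennreal"
  \<comment> \<open>\<open>S t\<close> lies on the sphere of squared radius
    \<open>\<rho>\<^sup>2 - t\<^sup>2\<close> around \<open>t *\<^sub>R e\<close> within the
    hyperplane at height \<open>t\<close>.\<close>
  have sq: "(norm (\<xi> - t *\<^sub>R e))\<^sup>2 = \<rho>\<^sup>2 - t\<^sup>2" if "\<xi> \<in> S t" for \<xi> t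
  proof -
    have "\<xi> \<bullet> \<xi> = \<rho>\<^sup>2" using that by (simp add: S_def dot_square_norm)
    then show ?thesis
      using that e unfolding power2_norm_eq_inner
      by (simp add: S_def inner_diff inner_commute power2_eq_square algebra_simps)
  qed
  have "?H (S b) = 0"
  \<comment> \<open>A hyperplane that touches or misses the sphere cuts out at most one point, which
    is null since \<open>0 < k\<close>.\<close>
  proof (cases "\<rho>\<^sup>2 \<le> b\<^sup>2")
    case True
    have "S b \<subseteq> {b *\<^sub>R e}"
    proof
      fix \<xi> assume "\<xi> \<in> S b"
      then have "(norm (\<xi> - b *\<^sub>R e))\<^sup>2 \<le> 0" using sq True by simp
      then show "\<xi> \<in> {b *\<^sub>R e}" by simp
    qed
    then have "?H (S b) \<le> ?H {b *\<^sub>R e}" by (rule hausdorff_measure_mono)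
    then show ?thesis by (simp add: hausdorff_measure_singleton \<open>0 < k\<close>)
  next
    case False
    \<comment> \<open>For heights up to \<open>\<rho> / 2\<close> the squared radius of the slice is
      at least \<open>3 / 4 * \<rho>\<^sup>2\<close>, so the ratio \<open>s\<close> of the two radii
      is at most 2.\<close>
    have compare: "?H (S b) \<le> ennreal (2 ^ k) * ?H (S t)" if t: "0 < t" "t \<le> \<rho> / 2" for t
    proof -
      have "t\<^sup>2 \<le> (\<rho> / 2)\<^sup>2" using t by (intro power_mono) auto
      then have "4 * t\<^sup>2 \<le> \<rho>\<^sup>2" by (simp add: power_divide)
      moreover have "0 < \<rho>\<^sup>2" using \<open>0 < \<rho>\<close> by simp
      ultimately have t2: "\<rho>\<^sup>2 \<le> 4 * (\<rho>\<^sup>2 - t\<^sup>2)" by argo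
      with \<open>0 < \<rho>\<^sup>2\<close> have t2': "0 < \<rho>\<^sup>2 - t\<^sup>2" by argo
      define s where "s = sqrt ((\<rho>\<^sup>2 - b\<^sup>2) / (\<rho>\<^sup>2 - t\<^sup>2))"
      have s2: "s\<^sup>2 = (\<rho>\<^sup>2 - b\<^sup>2) / (\<rho>\<^sup>2 - t\<^sup>2)" and "0 < s"
        using False t2' by (auto simp: s_def)
      have "(\<rho>\<^sup>2 - b\<^sup>2) / (\<rho>\<^sup>2 - t\<^sup>2) \<le> 2\<^sup>2"
        using t2 t2' by (simp add: field_simps) (smt (verit) zero_le_power2)
      then have "s \<le> 2" unfolding s_def by (intro real_le_lsqrt) auto
      \<comment> \<open>\<open>g\<close> moves the centre \<open>t *\<^sub>R e\<close> to
        \<open>b *\<^sub>R e\<close> and scales by \<open>s\<close> around it, so it takes the slice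
        at height \<open>t\<close> onto the one at height \<open>b\<close>.\<close>
      define g where "g \<eta> = b *\<^sub>R e + s *\<^sub>R (\<eta> - t *\<^sub>R e)" for \<eta> :: 'a
      have "S b \<subseteq> g ` S t"
      proof
        fix \<xi> assume \<xi>: "\<xi> \<in> S b"
        define z where "z = (1 / s) *\<^sub>R (\<xi> - b *\<^sub>R e)"
        have "z \<bullet> e = 0" using \<xi> e by (simp add: z_def S_def inner_diff)
        have "(norm z)\<^sup>2 = \<rho>\<^sup>2 - t\<^sup>2"
          using sq[OF \<xi>] s2 \<open>0 < s\<close> False t2'
          by (simp add: z_def power_mult_distrib power_divide)
        then have "z \<bullet> z = \<rho>\<^sup>2 - t\<^sup>2" by (simp add: power2_norm_eq_inner)
        then have "(norm (t *\<^sub>R e + z))\<^sup>2 = \<rho>\<^sup>2"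
          using \<open>z \<bullet> e = 0\<close> e unfolding power2_norm_eq_inner
          by (simp add: inner_add inner_commute power2_eq_square)
        then have "t *\<^sub>R e + z \<in> S t"
          using \<open>z \<bullet> e = 0\<close> e \<open>0 < \<rho>\<close> by (simp add: S_def inner_add power2_eq_iff_nonneg)
        moreover have "\<xi> = g (t *\<^sub>R e + z)" using \<open>0 < s\<close> by (simp add: g_def z_def)
        ultimately show "\<xi> \<in> g ` S t" by blast
      qed
      then have "?H (S b) \<le> ?H (g ` S t)" by (rule hausdorff_measure_mono)
      also have "\<dots> \<le> ennreal (2 ^ k) * ?H (S t)"
      proof (rule hausdorff_measure_Lipschitz_image_le)
        fix x y
        have "g x - g y = s *\<^sub>R (x - y)" by (simp add: g_def algebra_simps)
        then have "dist (g x) (g y) = s * dist x y" using \<open>0 < s\<close> by (simp add: dist_norm)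
        then show "dist (g x) (g y) \<le> 2 * dist x y" using \<open>s \<le> 2\<close> by (simp add: mult_right_mono)
      qed simp
      finally show ?thesis .
    qed
    define t where "t n = \<rho> / (2 * real (Suc n))" for n
    have t: "0 < t n" "t n \<le> \<rho> / 2" for n
      using \<open>0 < \<rho>\<close> by (auto simp: t_def field_simps)
    have inj: "m = n" if "t m = t n" for m n
      using that \<open>0 < \<rho>\<close> by (simp add: t_def field_simps)
    have closed: "closed (S t)" for t
      unfolding S_def by (intro closed_Int closed_sphere closed_Collect_eq continuous_intros)
    have fin: "?H (sphere 0 \<rho>) < \<infinity>"
      using hausdorff_measure_sphere_finite[OF \<open>0 < \<rho>\<close>] by (simp add: k_def)
    have bound: "of_nat m * ?H (S b) \<le> ennreal (2 ^ k) * ?H (sphere 0 \<rho>)" for m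
    proof -
      have "of_nat m * ?H (S b) = (\<Sum>n<m. ?H (S b))" by simp
      also have "\<dots> \<le> (\<Sum>n<m. ennreal (2 ^ k) * ?H (S (t n)))"
        by (intro sum_mono compare t)
      also have "\<dots> = ennreal (2 ^ k) * (\<Sum>n<m. emeasure (hausdorff_borel k) (S (t n)))"
        using closed by (simp add: sum_distrib_left emeasure_hausdorff_borel)
      also have "(\<Sum>n<m. emeasure (hausdorff_borel k) (S (t n)))
          = emeasure (hausdorff_borel k) (\<Union>n<m. S (t n))"
        using closed inj by (intro sum_emeasure) (auto simp: disjoint_family_on_def S_def)
      also have "\<dots> = ?H (\<Union>n<m. S (t n))"
        using closed by (intro emeasure_hausdorff_borel) auto
      also have "\<dots> \<le> ?H (sphere 0 \<rho>)"
        by (rule hausdorff_measure_mono) (auto simp: S_def)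
      finally show ?thesis by (simp add: mult_left_mono)
    qed
    have "?H (S b) \<le> ?H (sphere 0 \<rho>)" by (rule hausdorff_measure_mono) (auto simp: S_def)
    then obtain h where h: "?H (S b) = ennreal h" "0 \<le> h"
      using fin by (cases "?H (S b)") auto
    obtain B where B: "?H (sphere 0 \<rho>) = ennreal B" "0 \<le> B"
      using fin by (cases "?H (sphere 0 \<rho>)") auto
    have "real m * h \<le> 2 ^ k * B" for m
    proof -
      have "ennreal (real m * h) \<le> ennreal (2 ^ k * B)"
        using bound[of m] h B
        by (simp add: ennreal_of_nat_eq_real_of_nat ennreal_mult[symmetric] del: ennreal_power)
      then show ?thesis using B by simp
    qed
    \<comment> \<open>By the Archimedean property a positive \<open>h\<close> would have unbounded
      multiples.\<close>
    then have "h = 0" using h reals_Archimedean3[of h] by (metis not_le order_le_less)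
    then show ?thesis using h by simp
  qed
  then show ?thesis by (simp add: Sb k_def)
qed

section \<open>Restricted normal cones\<close>

text \<open>The reflection \<open>r\<close> is an isometric involution, so the part of
  \<open>N\<close> outside the half-space has the measure of its image inside. Only subadditivity
  enters, so \<open>N\<close> may be arbitrary.\<close>

lemma hausdorff_measure_le_twice_half_space:
  fixes e :: "'a::real_inner"
  assumes "norm e = 1"
    and refl: "\<And>y. y \<in> N \<Longrightarrow> y \<bullet> e < 0 \<Longrightarrow> y - (2 * (y \<bullet> e)) *\<^sub>R e \<in> N"
  shows "hausdorff_measure k N \<le> 2 * hausdorff_measure k (N \<inter> half_space e)"
proof -
  have e: "e \<bullet> e = 1" using \<open>norm e = 1\<close> by (simp add: dot_square_norm)
  define r where "r y = y - (2 * (y \<bullet> e)) *\<^sub>R e" for y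
  have r_r: "r (r y) = y" for y
    using e by (simp add: r_def inner_diff algebra_simps)
  have norm_r: "norm (r y) = norm y" for y
    using e by (simp add: r_def norm_eq_sqrt_inner inner_diff inner_commute algebra_simps)
  have dist_r: "dist (r x) (r y) = dist x y" for x y
  proof -
    have "r x - r y = r (x - y)" by (simp add: r_def inner_diff algebra_simps)
    then show ?thesis by (simp add: dist_norm norm_r)
  qed
  have "r y \<in> N \<inter> half_space e" if "y \<in> N - half_space e" for y
  proof -
    have neg: "y \<bullet> e < 0" using that by (simp add: half_space_def)
    then have "r y \<in> N" using refl that by (simp add: r_def)
    moreover have "r y \<bullet> e = - (y \<bullet> e)" using e by (simp add: r_def inner_diff)
    ultimately show ?thesis using neg by (simp add: half_space_def)
  qed
  then have "r ` (N - half_space e) \<subseteq> N \<inter> half_space e" by blast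
  then have "hausdorff_measure k (r ` (N - half_space e)) \<le> hausdorff_measure k (N \<inter> half_space e)"
    by (rule hausdorff_measure_mono)
  moreover have "N - half_space e = r ` r ` (N - half_space e)"
    by (simp add: image_image r_r)
  then have "hausdorff_measure k (N - half_space e) \<le> hausdorff_measure k (r ` (N - half_space e))"
    using hausdorff_measure_Lipschitz_image_le[of 1 "r ` (N - half_space e)" r k] dist_r by simp
  moreover have "hausdorff_measure k N
      \<le> hausdorff_measure k (N \<inter> half_space e) + hausdorff_measure k (N - half_space e)"
    using hausdorff_measure_Un_le[of k "N \<inter> half_space e" "N - half_space e"] by (simp add: Int_Diff_Un)
  ultimately have "hausdorff_measure k N
      \<le> hausdorff_measure k (N \<inter> half_space e) + hausdorff_measure k (N \<inter> half_space e)"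
    by (meson add_left_mono order_trans)
  then show ?thesis by (simp add: mult_2)
qed

text \<open>Since \<open>y \<bullet> e < 0\<close>, reflecting adds a positive multiple of
  \<open>e\<close>, which can only lower the products with \<open>x - p\<close>; the norm is
  kept.\<close>

lemma gen_normal_cone_reflection:
  assumes "norm e = 1" "\<And>x. x \<in> X \<Longrightarrow> (x - p) \<bullet> e \<le> 0"
    and y: "y \<in> gen_normal_cone u \<rho> X p" "y \<bullet> e < 0"
  shows "y - (2 * (y \<bullet> e)) *\<^sub>R e \<in> gen_normal_cone u \<rho> X p"
proof -
  have e: "e \<bullet> e = 1" using \<open>norm e = 1\<close> by (simp add: dot_square_norm)
  have "norm (y - (2 * (y \<bullet> e)) *\<^sub>R e) = norm y"
    using e by (simp add: norm_eq_sqrt_inner inner_diff inner_commute algebra_simps)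
  moreover have "(x - p) \<bullet> (y - (2 * (y \<bullet> e)) *\<^sub>R e) \<le> u x - u p" if "x \<in> X" for x
  proof -
    have "0 \<le> (2 * (y \<bullet> e)) * ((x - p) \<bullet> e)"
      using assms(2)[OF that] y by (intro mult_nonpos_nonpos) auto
    moreover have "(x - p) \<bullet> y \<le> u x - u p" using y that by (simp add: gen_normal_cone_def)
    ultimately show ?thesis by (simp add: inner_diff_right)
  qed
  ultimately show ?thesis using y by (simp add: gen_normal_cone_def)
qed

section \<open>Normal cones covering the sphere, and the estimate for finite sets\<close>

text \<open>A maximiser \<open>p\<close> of \<open>x \<bullet> \<xi> - u x\<close> over
  \<open>X\<close> is a point whose cone contains \<open>\<xi>\<close>.\<close>

lemma sphere_subset_UN_gen_normal_cone:
  fixes X :: "'a::real_inner set"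
  assumes "compact X" "X \<noteq> {}" "continuous_on X u"
  shows "sphere 0 \<rho> \<subseteq> (\<Union>p\<in>X. gen_normal_cone u \<rho> X p)"
proof
  fix \<xi> :: 'a assume "\<xi> \<in> sphere 0 \<rho>"
  have "continuous_on X (\<lambda>x. x \<bullet> \<xi> - u x)" by (intro continuous_intros assms)
  then obtain p where "p \<in> X" "\<And>x. x \<in> X \<Longrightarrow> x \<bullet> \<xi> - u x \<le> p \<bullet> \<xi> - u p"
    using continuous_attains_sup[OF assms(1,2)] by blast
  then have "\<xi> \<in> gen_normal_cone u \<rho> X p"
    using \<open>\<xi> \<in> sphere 0 \<rho>\<close> by (force simp: gen_normal_cone_def inner_diff_left)
  then show "\<xi> \<in> (\<Union>p\<in>X. gen_normal_cone u \<rho> X p)" using \<open>p \<in> X\<close> by blast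
qed

text \<open>Closedness makes these cones Borel, as needed for additivity and for continuity from
  above.\<close>

lemma closed_restr_normal_cone_at:
  fixes X :: "'a::euclidean_space set"
  shows "closed (restr_normal_cone_at u \<rho> X \<sigma> p)"
proof -
  have "restr_normal_cone_at u \<rho> X \<sigma> p
      = sphere 0 \<rho> \<inter> (\<Inter>x\<in>X. {\<xi>. (x - p) \<bullet> \<xi> \<le> u x - u p}) \<inter> {\<xi>. 0 \<le> \<xi> \<bullet> \<sigma> p}"
    by (auto simp: restr_normal_cone_at_def gen_normal_cone_def half_space_def)
  then show ?thesis
    by (auto intro!: closed_Int closed_INT closed_sphere closed_Collect_le continuous_intros)
qed

lemma hausdorff_sphere_le_restr_normal_cone_finite:
  fixes X :: "'a::euclidean_space set" and \<rho> :: real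
  assumes "0 < \<rho>" "2 \<le> DIM('a)" "finite X" "X \<noteq> {}"
    and \<sigma>: "\<And>p. p \<in> X \<Longrightarrow> norm (\<sigma> p) = 1"
    and supp: "\<And>p x. p \<in> X \<Longrightarrow> x \<in> X \<Longrightarrow> (x - p) \<bullet> \<sigma> p \<le> 0"
  shows "hausdorff_measure (DIM('a) - 1) (sphere (0 :: 'a) \<rho>)
    \<le> 2 * hausdorff_measure (DIM('a) - 1) (restr_normal_cone u \<rho> X \<sigma>)"
proof -
  let ?H = "hausdorff_measure (DIM('a) - 1) :: 'a set \<Rightarrow> ennreal"
  let ?M = "hausdorff_borel (DIM('a) - 1) :: 'a measure"
  \<comment> \<open>The directions in which \<open>p\<close> and \<open>q\<close> give equal values
    of \<open>x \<bullet> \<xi> - u x\<close>; any common element of their cones is of this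
    kind.\<close>
  define slice where "slice p q = sphere 0 \<rho> \<inter> {\<xi>. \<xi> \<bullet> (q - p) = u q - u p}" for p q
  define T where "T = (\<Union>(p, q)\<in>{(p, q) \<in> X \<times> X. p \<noteq> q}. slice p q)"
  have fin: "finite {(p, q) \<in> X \<times> X. p \<noteq> q}"
    by (rule finite_subset[of _ "X \<times> X"]) (use \<open>finite X\<close> in auto)
  have closed_slice: "closed (slice p q)" for p q
    unfolding slice_def by (intro closed_Int closed_sphere closed_Collect_eq continuous_intros)
  have "closed T"
    unfolding T_def case_prod_unfold by (intro closed_UN fin[unfolded case_prod_unfold] ballI closed_slice)
  have slice_null: "?H (slice p q) = 0" if "p \<noteq> q" for p q
    unfolding slice_def by (rule hausdorff_measure_sphere_slice) (use assms that in auto)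
  have "?H T \<le> (\<Sum>(p, q)\<in>{(p, q) \<in> X \<times> X. p \<noteq> q}. ?H (slice p q))"
    unfolding T_def
    using hausdorff_measure_finite_subadditive[OF fin, of "DIM('a) - 1" "\<lambda>(p, q). slice p q"]
    by (simp add: case_prod_unfold)
  also have "\<dots> = 0"
    using slice_null by (intro sum.neutral) auto
  finally have T0: "?H T = 0" by simp
  \<comment> \<open>Removing the null set \<open>T\<close> makes the cones disjoint without changing
    their measure.\<close>
  define B where "B p = restr_normal_cone_at u \<rho> X \<sigma> p - T" for p
  have B_borel: "B p \<in> sets borel" for p
    unfolding B_def using closed_restr_normal_cone_at \<open>closed T\<close> by (intro sets.Diff borel_closed)
  have tie: "\<xi> \<in> slice p q"
    if "p \<in> X" "q \<in> X" "\<xi> \<in> restr_normal_cone_at u \<rho> X \<sigma> p" "\<xi> \<in> restr_normal_cone_at u \<rho> X \<sigma> q" for p q \<xi>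
  proof -
    have "(q - p) \<bullet> \<xi> \<le> u q - u p" "(p - q) \<bullet> \<xi> \<le> u p - u q" "\<xi> \<in> sphere 0 \<rho>"
      using that by (auto simp: restr_normal_cone_at_def gen_normal_cone_def)
    then show ?thesis by (simp add: slice_def inner_diff_left inner_diff_right inner_commute)
  qed
  have disj: "disjoint_family_on B X"
  unfolding disjoint_family_on_def
  proof (intro ballI impI)
    fix p q assume "p \<in> X" "q \<in> X" "p \<noteq> q"
    moreover from this have "slice p q \<subseteq> T" unfolding T_def by blast
    ultimately show "B p \<inter> B q = {}" using tie unfolding B_def by blast
  qed
  have cone_le: "?H (gen_normal_cone u \<rho> X p) \<le> 2 * ?H (B p)" if "p \<in> X" for p
  proof -
    have "?H (gen_normal_cone u \<rho> X p) \<le> 2 * ?H (restr_normal_cone_at u \<rho> X \<sigma> p)"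
      unfolding restr_normal_cone_at_def using that \<sigma> supp
      by (intro hausdorff_measure_le_twice_half_space gen_normal_cone_reflection) auto
    also have "?H (restr_normal_cone_at u \<rho> X \<sigma> p) \<le> ?H (B p \<union> T)"
      by (rule hausdorff_measure_mono) (auto simp: B_def)
    also have "\<dots> \<le> ?H (B p)"
      using hausdorff_measure_Un_le[of _ "B p" T] T0 by (metis add.right_neutral)
    finally show ?thesis by (simp add: mult_left_mono)
  qed
  have "?H (sphere 0 \<rho>) \<le> ?H (\<Union>p\<in>X. gen_normal_cone u \<rho> X p)"
    using assms by (intro hausdorff_measure_mono sphere_subset_UN_gen_normal_cone)
      (auto intro: finite_imp_compact continuous_on_finite)
  also have "\<dots> \<le> (\<Sum>p\<in>X. ?H (gen_normal_cone u \<rho> X p))"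
    using \<open>finite X\<close> by (rule hausdorff_measure_finite_subadditive)
  also have "\<dots> \<le> (\<Sum>p\<in>X. 2 * ?H (B p))"
    by (intro sum_mono cone_le)
  also have "\<dots> = 2 * (\<Sum>p\<in>X. emeasure ?M (B p))"
    using B_borel by (simp add: sum_distrib_left emeasure_hausdorff_borel)
  also have "(\<Sum>p\<in>X. emeasure ?M (B p)) = emeasure ?M (\<Union>p\<in>X. B p)"
    using B_borel disj \<open>finite X\<close> by (intro sum_emeasure) auto
  also have "\<dots> = ?H (\<Union>p\<in>X. B p)"
    using B_borel \<open>finite X\<close> by (intro emeasure_hausdorff_borel) auto
  also have "\<dots> \<le> ?H (restr_normal_cone u \<rho> X \<sigma>)"
    by (rule hausdorff_measure_mono) (auto simp: restr_normal_cone_def B_def)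
  finally show ?thesis by (simp add: mult_left_mono)
qed

section \<open>From finite to compact sets\<close>

text \<open>If \<open>\<xi>\<close> lies in infinitely many of the finite restricted cones, their
  base points have a cluster point \<open>l\<close> in \<open>X\<close>. By continuity of
  \<open>u\<close> and \<open>\<sigma>\<close> the defining inequalities survive the limit and put
  \<open>\<xi>\<close> in the cone at \<open>l\<close>.\<close>

lemma restr_normal_cone_limsup_subset:
  fixes X :: "'a::euclidean_space set"
  assumes "compact X" "continuous_on X u" "continuous_on X \<sigma>"
    and D: "countable D" "D \<noteq> {}" "D \<subseteq> X" "X \<subseteq> closure D"
  shows "(\<Inter>n. \<Union>m\<in>{n..}. restr_normal_cone u \<rho> (from_nat_into D ` {..m}) \<sigma>)
    \<subseteq> restr_normal_cone u \<rho> X \<sigma>"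
proof
  fix \<xi> assume "\<xi> \<in> (\<Inter>n. \<Union>m\<in>{n..}. restr_normal_cone u \<rho> (from_nat_into D ` {..m}) \<sigma>)"
  then have "\<forall>n. \<exists>p m. n \<le> m \<and> p \<in> from_nat_into D ` {..m} \<and>
      \<xi> \<in> restr_normal_cone_at u \<rho> (from_nat_into D ` {..m}) \<sigma> p"
    by (simp add: restr_normal_cone_def) blast
  then obtain p m where m: "\<And>n. n \<le> m n" and p: "\<And>n. p n \<in> from_nat_into D ` {..m n}"
    and \<xi>: "\<And>n. \<xi> \<in> restr_normal_cone_at u \<rho> (from_nat_into D ` {..m n}) \<sigma> (p n)"
    by metis
  have pX: "p n \<in> X" for n
    using p[of n] from_nat_into[OF D(2)] D(3) by auto
  then obtain l r where l: "l \<in> X" and r: "strict_mono r" and lim: "(p \<circ> r) \<longlonglongrightarrow> l"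
    using \<open>compact X\<close> unfolding compact_def by blast
  have limu: "(\<lambda>n. u (p (r n))) \<longlonglongrightarrow> u l" and lim\<sigma>: "(\<lambda>n. \<sigma> (p (r n))) \<longlonglongrightarrow> \<sigma> l"
    using assms(2,3) l pX lim unfolding continuous_on_sequentially comp_def by auto
  have "(\<lambda>n. \<xi> \<bullet> \<sigma> (p (r n))) \<longlonglongrightarrow> \<xi> \<bullet> \<sigma> l" by (intro tendsto_intros lim\<sigma>)
  then have "0 \<le> \<xi> \<bullet> \<sigma> l"
    using \<xi> by (intro LIMSEQ_le_const) (auto simp: restr_normal_cone_at_def half_space_def)
  \<comment> \<open>Each \<open>x\<close> in \<open>D\<close> belongs to all sufficiently late
    finite sets, so its inequality holds eventually; density of \<open>D\<close> then extends the
    result to \<open>X\<close>.\<close>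
  have on_D: "(x - l) \<bullet> \<xi> \<le> u x - u l" if "x \<in> D" for x
  proof (rule LIMSEQ_le)
    show "(\<lambda>n. (x - p (r n)) \<bullet> \<xi>) \<longlonglongrightarrow> (x - l) \<bullet> \<xi>"
      using lim by (intro tendsto_intros) (simp add: comp_def)
    show "(\<lambda>n. u x - u (p (r n))) \<longlonglongrightarrow> u x - u l" by (intro tendsto_intros limu)
    obtain i where i: "x = from_nat_into D i"
      using \<open>x \<in> D\<close> D(1) from_nat_into_surj by metis
    have "(x - p (r n)) \<bullet> \<xi> \<le> u x - u (p (r n))" if "i \<le> n" for n
    proof -
      have "i \<le> m (r n)" using that m[of "r n"] seq_suble[OF r, of n] by simp
      then have "x \<in> from_nat_into D ` {..m (r n)}" using i by blast
      then show ?thesis using \<xi>[of "r n"]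
        unfolding restr_normal_cone_at_def gen_normal_cone_def by blast
    qed
    then show "\<exists>N. \<forall>n\<ge>N. (x - p (r n)) \<bullet> \<xi> \<le> u x - u (p (r n))" by blast
  qed
  have "(x - l) \<bullet> \<xi> \<le> u x - u l" if "x \<in> X" for x
  proof -
    obtain d where d: "\<And>n. d n \<in> D" "d \<longlonglongrightarrow> x"
      using \<open>x \<in> X\<close> D(4) closure_sequential[of x D] by blast
    have "(\<lambda>n. u (d n)) \<longlonglongrightarrow> u x"
      using assms(2) that d D(3) unfolding continuous_on_sequentially comp_def by blast
    then show ?thesis
      using d on_D by (intro LIMSEQ_le[where X = "\<lambda>n. (d n - l) \<bullet> \<xi>" and Y = "\<lambda>n. u (d n) - u l"])
        (auto intro!: tendsto_intros)
  qed
  moreover have "\<xi> \<in> sphere 0 \<rho>"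
    using \<xi>[of 0] by (simp add: restr_normal_cone_at_def gen_normal_cone_def)
  ultimately have "\<xi> \<in> restr_normal_cone_at u \<rho> X \<sigma> l"
    using \<open>0 \<le> \<xi> \<bullet> \<sigma> l\<close> by (simp add: restr_normal_cone_at_def gen_normal_cone_def half_space_def)
  then show "\<xi> \<in> restr_normal_cone u \<rho> X \<sigma>" using l by (auto simp: restr_normal_cone_def)
qed

lemma hausdorff_sphere_le_restr_normal_cone_compact:
  fixes X :: "'a::euclidean_space set" and \<rho> :: real
  assumes "0 < \<rho>" "2 \<le> DIM('a)" "compact X" "X \<noteq> {}" "continuous_on X u" "continuous_on X \<sigma>"
    and \<sigma>: "\<And>p. p \<in> X \<Longrightarrow> norm (\<sigma> p) = 1"
    and supp: "\<And>p x. p \<in> X \<Longrightarrow> x \<in> X \<Longrightarrow> (x - p) \<bullet> \<sigma> p \<le> 0"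
  shows "hausdorff_measure (DIM('a) - 1) (sphere (0 :: 'a) \<rho>)
    \<le> 2 * hausdorff_measure (DIM('a) - 1) (restr_normal_cone u \<rho> X \<sigma>)"
proof -
  let ?H = "hausdorff_measure (DIM('a) - 1) :: 'a set \<Rightarrow> ennreal"
  let ?M = "hausdorff_borel (DIM('a) - 1) :: 'a measure"
  obtain D where D: "countable D" "D \<subseteq> X" "X \<subseteq> closure D" by (rule separable)
  have "D \<noteq> {}" using D \<open>X \<noteq> {}\<close> by auto
  \<comment> \<open>\<open>from_nat_into D\<close> runs through all of \<open>D\<close>; if
    \<open>D\<close> is finite, the surplus indices repeat elements of \<open>D\<close>.\<close>
  define A where "A m = restr_normal_cone u \<rho> (from_nat_into D ` {..m}) \<sigma>" for m
  define B where "B n = (\<Union>m\<in>{n..}. A m)" for n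
  have DX: "from_nat_into D i \<in> X" for i
    using from_nat_into[OF \<open>D \<noteq> {}\<close>] D by blast
  have A_half: "?H (sphere 0 \<rho>) \<le> 2 * ?H (A m)" for m
    unfolding A_def using DX \<sigma> supp assms(1,2) by (intro hausdorff_sphere_le_restr_normal_cone_finite) auto
  have "A m \<in> sets borel" for m
    unfolding A_def restr_normal_cone_def
    by (auto intro!: borel_closed closed_UN closed_restr_normal_cone_at)
  then have B_borel: "B n \<in> sets borel" for n unfolding B_def by auto
  have sphere: "B n \<subseteq> sphere 0 \<rho>" for n
    by (auto simp: B_def A_def restr_normal_cone_def restr_normal_cone_at_def gen_normal_cone_def)
  \<comment> \<open>Finite measure is what allows the decreasing limit to be exchanged with the
    measure.\<close>
  have "?H (B n) < \<infinity>" for n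
    using hausdorff_measure_sphere_finite[OF \<open>0 < \<rho>\<close>] hausdorff_measure_mono[OF sphere]
    by (rule order_le_less_trans[rotated])
  moreover have "decseq B"
    unfolding B_def decseq_def by (intro allI impI UN_mono) auto
  ultimately have "(\<lambda>n. emeasure ?M (B n)) \<longlonglongrightarrow> emeasure ?M (\<Inter>n. B n)"
    using B_borel by (intro Lim_emeasure_decseq)
      (auto simp: emeasure_hausdorff_borel less_top)
  then have "(\<lambda>n. 2 * ?H (B n)) \<longlonglongrightarrow> 2 * ?H (\<Inter>n. B n)"
    using B_borel by (intro ennreal_tendsto_cmult) (auto simp: emeasure_hausdorff_borel)
  moreover have "?H (sphere 0 \<rho>) \<le> 2 * ?H (B n)" for n
    by (rule order_trans[OF A_half[of n]])
      (auto simp: B_def intro!: mult_left_mono hausdorff_measure_mono)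
  ultimately have "?H (sphere 0 \<rho>) \<le> 2 * ?H (\<Inter>n. B n)"
    by (intro LIMSEQ_le_const) auto
  also have "\<dots> \<le> 2 * ?H (restr_normal_cone u \<rho> X \<sigma>)"
    unfolding B_def A_def using assms D \<open>D \<noteq> {}\<close>
    by (intro mult_left_mono hausdorff_measure_mono restr_normal_cone_limsup_subset) auto
  finally show ?thesis .
qed

section \<open>The case of dimension one\<close>

text \<open>Any cover of \<open>A\<close> has a nonempty member, whose weight for
  \<open>k = 0\<close> is 1.\<close>

lemma one_le_hausdorff_measure_0:
  fixes A :: "'a::metric_space set"
  assumes "A \<noteq> {}"
  shows "1 \<le> hausdorff_measure 0 A"
proof -
  have "1 \<le> hausdorff_content 0 1 A"
    unfolding hausdorff_content_def
  proof (rule INF_greatest, clarify)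
    fix C :: "nat \<Rightarrow> 'a set" assume "A \<subseteq> (\<Union>i. C i)"
    then obtain i where "C i \<noteq> {}" using assms by blast
    then have "1 = hausdorff_weight 0 (C i)" by (simp add: hausdorff_weight_def)
    also have "\<dots> \<le> (\<Sum>i. hausdorff_weight 0 (C i))"
      using sum_le_suminf[of "\<lambda>i. hausdorff_weight 0 (C i)" "{i}"] by simp
    finally show "1 \<le> (\<Sum>i. hausdorff_weight 0 (C i))" .
  qed
  also have "\<dots> \<le> hausdorff_measure 0 A" by (rule hausdorff_content_le_measure) simp
  finally show ?thesis .
qed

lemma hausdorff_measure_0_sphere_le:
  assumes "DIM('a) = 1"
  shows "hausdorff_measure 0 (sphere (0 :: 'a::euclidean_space) \<rho>) \<le> 2"
proof -
  obtain b :: 'a where b: "Basis = {b}" using assms card_1_singletonE by blast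
  have "sphere (0 :: 'a) \<rho> \<subseteq> (\<Union>x\<in>{\<rho> *\<^sub>R b, - \<rho> *\<^sub>R b}. {x})"
  proof
    fix x :: 'a assume "x \<in> sphere 0 \<rho>"
    have "norm b = 1" using b by (metis insertI1 norm_Basis)
    have x: "x = (x \<bullet> b) *\<^sub>R b" using euclidean_representation[of x] unfolding b by simp
    have "\<bar>x \<bullet> b\<bar> = \<rho>"
      using \<open>x \<in> sphere 0 \<rho>\<close> \<open>norm b = 1\<close> by (subst (asm) x) simp
    then have "x \<bullet> b = \<rho> \<or> x \<bullet> b = - \<rho>" by linarith
    then show "x \<in> (\<Union>x\<in>{\<rho> *\<^sub>R b, - \<rho> *\<^sub>R b}. {x})" using x by auto
  qed
  then have "hausdorff_content 0 \<delta> (sphere (0 :: 'a) \<rho>)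
      \<le> (\<Sum>x\<in>{\<rho> *\<^sub>R b, - \<rho> *\<^sub>R b}. hausdorff_weight 0 {x})" if "0 < \<delta>" for \<delta>
    using that by (intro hausdorff_content_finite_cover) auto
  also have "(\<Sum>x\<in>{\<rho> *\<^sub>R b, - \<rho> *\<^sub>R b}. hausdorff_weight 0 {x})
      = of_nat (card {\<rho> *\<^sub>R b, - \<rho> *\<^sub>R b})"
    by (simp add: hausdorff_weight_def)
  also have "\<dots> \<le> of_nat 2" by (rule of_nat_mono) (simp add: card_insert_if)
  finally show ?thesis by (intro hausdorff_measure_leI[of 1]) auto
qed

text \<open>Any vector of the sphere lies in some cone; if it is on the wrong side of the hyperplane
  there, its reflection lies in the restricted cone.\<close>

lemma restr_normal_cone_nonempty:
  fixes X :: "'a::euclidean_space set" and \<rho> :: real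
  assumes "0 < \<rho>" "compact X" "X \<noteq> {}" "continuous_on X u"
    and \<sigma>: "\<And>p. p \<in> X \<Longrightarrow> norm (\<sigma> p) = 1"
    and supp: "\<And>p x. p \<in> X \<Longrightarrow> x \<in> X \<Longrightarrow> (x - p) \<bullet> \<sigma> p \<le> 0"
  shows "restr_normal_cone u \<rho> X \<sigma> \<noteq> {}"
proof -
  obtain \<xi> :: 'a where "\<xi> \<in> sphere 0 \<rho>"
    using \<open>0 < \<rho>\<close> by (metis less_imp_le mem_sphere_0 vector_choose_size)
  then obtain p where p: "p \<in> X" and \<xi>: "\<xi> \<in> gen_normal_cone u \<rho> X p"
    using sphere_subset_UN_gen_normal_cone[OF assms(2-4)] by blast
  have "\<exists>\<eta>. \<eta> \<in> gen_normal_cone u \<rho> X p \<and> 0 \<le> \<eta> \<bullet> \<sigma> p"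
  proof (cases "0 \<le> \<xi> \<bullet> \<sigma> p")
    case False
    have "\<sigma> p \<bullet> \<sigma> p = 1" using \<sigma>[OF p] by (simp add: dot_square_norm)
    then show ?thesis
      using False gen_normal_cone_reflection[OF \<sigma>[OF p] supp[OF p] \<xi>]
      by (intro exI[of _ "\<xi> - (2 * (\<xi> \<bullet> \<sigma> p)) *\<^sub>R \<sigma> p"]) (simp add: inner_diff_left)
  qed (use \<xi> in blast)
  then show ?thesis
    using p by (auto simp: restr_normal_cone_def restr_normal_cone_at_def half_space_def)
qed

theorem proposition2p4:
  fixes \<rho> \<rho>t :: real
    and X :: "(real ^ 'n) set"
    and u :: "real ^ 'n \<Rightarrow> real"
    and \<sigma> :: "real ^ 'n \<Rightarrow> real ^ 'n"
  assumes "0 < \<rho>"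
    and "\<rho>t = sqrt (1 + \<rho>\<^sup>2)"
    and "X \<noteq> {}"
    and "compact X"
    and "X \<inter> rel_interior (convex hull X) = {}"
    and "continuous_on X u"
    and "continuous_on X \<sigma>"
    and "\<sigma> ` X \<subseteq> sphere 0 1"
    and "\<And>p. p \<in> X \<Longrightarrow> \<rho>t *\<^sub>R (\<sigma> p, 0) \<in> normal_cone \<rho>t (graph_over X u) (p, u p)"
  shows "hausdorff_measure (CARD('n) - 1) (restr_normal_cone u \<rho> X \<sigma>)
           \<ge> 1 / 2 * hausdorff_measure (CARD('n) - 1) (sphere (0 :: real ^ 'n) \<rho>)"
proof -
  let ?H = "hausdorff_measure (CARD('n) - 1) :: (real ^ 'n) set \<Rightarrow> ennreal"
  have "0 < \<rho>t" using assms(2) by (simp add: add_pos_nonneg)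
  have \<sigma>: "norm (\<sigma> p) = 1" if "p \<in> X" for p
    using assms(8) that by auto
  \<comment> \<open>The last coordinate of the given normal vector is 0, so the heights of the graph
    drop out and \<open>\<sigma> p\<close> supports \<open>X\<close> itself.\<close>
  have supp: "(x - p) \<bullet> \<sigma> p \<le> 0" if "p \<in> X" "x \<in> X" for p x
  proof -
    have "((x, u x) - (p, u p)) \<bullet> (\<rho>t *\<^sub>R (\<sigma> p, 0)) \<le> 0"
      using assms(9)[OF \<open>p \<in> X\<close>] \<open>x \<in> X\<close> by (auto simp: normal_cone_def graph_over_def)
    then show ?thesis using \<open>0 < \<rho>t\<close> by (simp add: mult_le_0_iff)
  qed
  have "?H (sphere 0 \<rho>) \<le> 2 * ?H (restr_normal_cone u \<rho> X \<sigma>)"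
  \<comment> \<open>In dimension one the measure counts points, so at most two on the sphere are
    compared with at least one in the restricted cone.\<close>
  proof (cases "CARD('n) = 1")
    case True
    have "?H (sphere 0 \<rho>) \<le> 2"
      using hausdorff_measure_0_sphere_le[where 'a = "real ^ 'n"] True by simp
    also have "\<dots> \<le> 2 * ?H (restr_normal_cone u \<rho> X \<sigma>)"
      using mult_left_mono[OF one_le_hausdorff_measure_0, of "restr_normal_cone u \<rho> X \<sigma>" 2]
        restr_normal_cone_nonempty[OF assms(1,4,3,6) \<sigma> supp] True by simp
    finally show ?thesis .
  next
    case False
    then have "2 \<le> CARD('n)" using zero_less_card_finite[where 'a = 'n] by linarith
    then show ?thesis
      using hausdorff_sphere_le_restr_normal_cone_compact[OF assms(1) _ assms(4,3,6,7) \<sigma> supp] by simp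
  qed
  then have "1 / 2 * ?H (sphere 0 \<rho>) \<le> 1 / 2 * (2 * ?H (restr_normal_cone u \<rho> X \<sigma>))"
    by (rule mult_left_mono) simp
  also have "\<dots> = ?H (restr_normal_cone u \<rho> X \<sigma>)"
    by (simp add: mult.assoc[symmetric] ennreal_divide_times)
  finally show ?thesis .
qed

end
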